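(* Let $g\colon\mathbf{R}^n\to\mathbf{R}\cup\{+\infty\}$ be a proper closed convex function, $f\colon\mathbf{R}^m\to\mathbf{R}$ a $C^1$-smooth convex function with Lipschitz continuous gradient, and $A\colon\mathbf{R}^n\to\mathbf{R}^m$ a linear map. Suppose that $\varphi(x):=f(Ax)+g(x)$ has a nonempty set $S$ of minimizers, with minimal value $\varphi^*$. Let $\Psi(y):=f^{\star}(y)+g^{\star}(-A^Ty)$, and let $\bar y$ be the optimal solution of the dual problem $\sup_y\,-\Psi(y)$. Suppose the following conditions hold: 1. (Compactness) the solution set $S$ is bounded. 2. (Dual nondegeneracy and strict complementarity) $0\in A^T(\mathrm{ri}\,\mathrm{dom}\,f^{\star})+\mathrm{ri}\,\mathrm{dom}\,g^{\star}$ and $0\in\mathrm{ri}\,\partial\Psi(\bar y)$. 3. (Quadratic growth of components) $f$ and $g$ are firmly convex relative to $\bar y$ and $-A^T\bar y$, respectively. Then the error bound condition holds with some parameters: for every $t>0$ there exist $\gamma,\nu>0$ such that $$\mathrm{dist}(x,S)\le\gamma\|\mathcal{G}_t(x)\|\qquad\text{for all }x\text{ with }\varphi(x)\le\varphi^*+\nu .$$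
   Context: $f^{\star}$ denotes the Fenchel conjugate, $\mathrm{ri}$ the relative interior, $\partial$ the convex subdifferential. Under the dual nondegeneracy condition the dual problem has a unique optimal solution, and it equals $\nabla f(Ax)$ for every $x\in S$. The prox-gradient mapping for this problem is $\mathcal{G}_t(x):=t^{-1}\big(x-\mathrm{prox}_{tg}(x-tA^T\nabla f(Ax))\big)$, where $\mathrm{prox}_{tg}(x):=\operatorname{argmin}_y\{g(y)+\frac1{2t}\|y-x\|^2\}$. Firm convexity: a closed convex function $h$ is firmly convex relative to a vector $v$ if the tilted function $h_v(x):=h(x)-\langle v,x\rangle$ satisfies: for any compact set $\mathcal{X}$ there is a constant $\alpha>0$ with $h_v(x)\ge(\inf h_v)+\frac{\alpha}{2}\,\mathrm{dist}^2\big(x,(\partial h_v)^{-1}(0)\big)$ for all $x\in\mathcal{X}$. Here $(\partial h_v)^{-1}(0)=\{x:0\in\partial h_v(x)\}$ is the set of minimizers of $h_v$. *)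

theory Defs
  imports "HOL-Analysis.Analysis"
begin

text \<open>
  Functions into the reals with infinity are functions into \<^typ>\<open>ereal\<close>; the value minus infinity
  is excluded by properness.
\<close>

definition effective_domain :: "('a \<Rightarrow> ereal) \<Rightarrow> 'a set" where
  "effective_domain h = {x. h x < \<infinity>}"

definition proper_fun :: "('a \<Rightarrow> ereal) \<Rightarrow> bool" where
  "proper_fun h \<longleftrightarrow> (\<forall>x. h x \<noteq> - \<infinity>) \<and> (\<exists>x. h x \<noteq> \<infinity>)"

text \<open>
  The library's \<^const>\<open>epigraph\<close> and \<^const>\<open>convex_on\<close> only cover real-valued functions.
\<close>

definition ereal_epigraph :: "('a \<Rightarrow> ereal) \<Rightarrow> ('a \<times> real) set" where
  "ereal_epigraph h = {(x, r). h x \<le> ereal r}"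

definition closed_convex_fun :: "('a::euclidean_space \<Rightarrow> ereal) \<Rightarrow> bool" where
  "closed_convex_fun h \<longleftrightarrow> closed (ereal_epigraph h) \<and> convex (ereal_epigraph h)"

definition fenchel_conjugate :: "('a::euclidean_space \<Rightarrow> ereal) \<Rightarrow> 'a \<Rightarrow> ereal" where
  "fenchel_conjugate h y = (SUP x. ereal (y \<bullet> x) - h x)"

definition subdifferential :: "('a::euclidean_space \<Rightarrow> ereal) \<Rightarrow> 'a \<Rightarrow> 'a set" where
  "subdifferential h x =
     {v. \<bar>h x\<bar> \<noteq> \<infinity> \<and> (\<forall>y. h x + ereal (v \<bullet> (y - x)) \<le> h y)}"

definition minimizers :: "('a \<Rightarrow> ereal) \<Rightarrow> 'a set" where
  "minimizers h = {x. is_arg_min h (\<lambda>_. True) x}"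

definition tilted :: "('a::euclidean_space \<Rightarrow> ereal) \<Rightarrow> 'a \<Rightarrow> 'a \<Rightarrow> ereal" where
  "tilted h v x = h x - ereal (v \<bullet> x)"

text \<open>
  Unlike \<^const>\<open>infdist\<close>, which is 0 for the empty set, this distance to the empty set is infinite,
  so that firm convexity does not hold vacuously when the tilted function has no minimizer.
\<close>

definition ereal_dist_set :: "'a::metric_space \<Rightarrow> 'a set \<Rightarrow> ereal" where
  "ereal_dist_set x Q = (INF q\<in>Q. ereal (dist x q))"

definition firmly_convex :: "('a::euclidean_space \<Rightarrow> ereal) \<Rightarrow> 'a \<Rightarrow> bool" where
  "firmly_convex h v \<longleftrightarrow> closed_convex_fun h \<and>
     (\<forall>X. compact X \<longrightarrow>
       (\<exists>\<alpha>>0. \<forall>x\<in>X.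
          tilted h v x \<ge> (INF z. tilted h v z)
            + ereal (\<alpha> / 2) * (ereal_dist_set x {z. 0 \<in> subdifferential (tilted h v) z})\<^sup>2))"

definition primal_obj ::
  "('b \<Rightarrow> real) \<Rightarrow> ('a \<Rightarrow> ereal) \<Rightarrow> ('a \<Rightarrow> 'b) \<Rightarrow> 'a \<Rightarrow> ereal" where
  "primal_obj f g A x = ereal (f (A x)) + g x"

definition dual_obj ::
  "('b::euclidean_space \<Rightarrow> real) \<Rightarrow> ('a::euclidean_space \<Rightarrow> ereal) \<Rightarrow> ('a \<Rightarrow> 'b) \<Rightarrow> 'b \<Rightarrow> ereal" where
  "dual_obj f g A y =
     fenchel_conjugate (\<lambda>z. ereal (f z)) y + fenchel_conjugate g (- adjoint A y)"

text \<open>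
  For proper closed convex \<open>g\<close> and \<open>t > 0\<close> the minimizer is unique, so the choice made by
  \<^const>\<open>arg_min\<close> is immaterial.
\<close>

definition prox :: "real \<Rightarrow> ('a::euclidean_space \<Rightarrow> ereal) \<Rightarrow> 'a \<Rightarrow> 'a" where
  "prox t g x = arg_min (\<lambda>y. g y + ereal (1 / (2 * t) * (norm (y - x))\<^sup>2)) (\<lambda>_. True)"

text \<open>The argument \<open>df\<close> is the gradient of \<open>f\<close>.\<close>

definition prox_gradient_map ::
  "('b::euclidean_space \<Rightarrow> 'b) \<Rightarrow> ('a::euclidean_space \<Rightarrow> ereal) \<Rightarrow> ('a \<Rightarrow> 'b) \<Rightarrow> real \<Rightarrow> 'a \<Rightarrow> 'a" where
  "prox_gradient_map df g A t x =
     (1 / t) *\<^sub>R (x - prox t g (x - t *\<^sub>R adjoint A (df (A x))))"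

end

theory Submission
  imports Defs
begin

text \<open>
  Let \<open>P\<close> and \<open>Q\<close> be the minimizer sets of the tilted functions \<open>f - \<langle>ybar, \<cdot>\<rangle>\<close> and
  \<open>g + \<langle>A\<^sup>T ybar, \<cdot>\<rangle>\<close>. Boundedness of \<open>S\<close> makes every shifted problem
  \<open>min f(A x + w) + g(x)\<close> solvable, and this yields \<open>\<partial>\<Psi>(ybar) = P - A Q\<close>; in particular
  \<open>S = {q \<in> Q. A q \<in> P}\<close>. Strict complementarity then says that \<open>0\<close> lies in the relative interior of
  \<open>P - A Q\<close>, so a nonzero residual \<open>p - A q\<close> can be cancelled by a convex combination
  with a residual of fixed size in the opposite direction. This gives
  \<open>dist(x, S) = O(dist(A x, P) + dist(x, Q))\<close> on bounded sets, and firm convexity turns it into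
  quadratic growth of the objective around \<open>S\<close>. Finally, the prox-gradient step \<open>u\<close> from \<open>x\<close> has a subgradient of
  size \<open>O(\<parallel>x - u\<parallel>)\<close>, so quadratic growth at \<open>u\<close> bounds \<open>dist(u, S)\<close> by a multiple of \<open>\<parallel>x - u\<parallel>\<close>.
\<close>

section \<open>Minimizers and lower level sets of closed convex functions\<close>

definition argmin_on :: "'a set \<Rightarrow> ('a \<Rightarrow> real) \<Rightarrow> 'a set" where
  "argmin_on C F = {x \<in> C. \<forall>y\<in>C. F x \<le> F y}"

lemma closed_lower_level:
  fixes F :: "'a::euclidean_space \<Rightarrow> real"
  assumes "closed (epigraph C F)"
  shows "closed {x \<in> C. F x \<le> r}"
proof -
  have "{x \<in> C. F x \<le> r} = (\<lambda>x. (x, r)) -` epigraph C F"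
    by (auto simp: mem_epigraph)
  then show ?thesis
    using assms by (simp add: closed_vimage continuous_on_Pair)
qed

lemma closed_epigraph_add:
  fixes G h :: "'a::euclidean_space \<Rightarrow> real"
  assumes "closed (epigraph C G)" "continuous_on UNIV h"
  shows "closed (epigraph C (\<lambda>x. h x + G x))"
proof -
  have "epigraph C (\<lambda>x. h x + G x) = (\<lambda>w. (fst w, snd w - h (fst w))) -` epigraph C G"
    by (auto simp: epigraph_def)
  moreover have "continuous_on UNIV (\<lambda>w::'a \<times> real. (fst w, snd w - h (fst w)))"
    by (intro continuous_intros continuous_on_compose2[OF assms(2)]) auto
  ultimately show ?thesis
    using assms by (auto intro!: closed_vimage)
qed

lemma closed_epigraph_Int:
  fixes F :: "'a::euclidean_space \<Rightarrow> real"
  assumes "closed (epigraph C F)" "closed K"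
  shows "closed (epigraph (C \<inter> K) F)"
proof -
  have "epigraph (C \<inter> K) F = epigraph C F \<inter> (K \<times> UNIV)"
    by (auto simp: epigraph_def)
  then show ?thesis
    using assms by (simp add: closed_Int closed_Times)
qed

lemma closed_epigraph_UNIV:
  fixes F :: "'a::euclidean_space \<Rightarrow> real"
  assumes "continuous_on UNIV F"
  shows "closed (epigraph UNIV F)"
proof -
  have "epigraph UNIV F = {w. F (fst w) \<le> snd w}"
    by (auto simp: epigraph_def)
  then show ?thesis
    by (auto intro!: closed_Collect_le continuous_intros continuous_on_compose2[OF assms])
qed

lemma closed_argmin_on:
  fixes F :: "'a::euclidean_space \<Rightarrow> real"
  assumes "closed (epigraph C F)"
  shows "closed (argmin_on C F)"
proof (cases "argmin_on C F = {}")
  case False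
  then obtain z where z: "z \<in> argmin_on C F" by auto
  then have "argmin_on C F = {x \<in> C. F x \<le> F z}"
    by (auto simp: argmin_on_def intro: order_trans)
  then show ?thesis
    using closed_lower_level[OF assms] by simp
qed auto

lemma convex_argmin_on:
  assumes "convex_on C F"
  shows "convex (argmin_on C F)"
proof (rule convexI)
  fix x y and u v :: real
  assume x: "x \<in> argmin_on C F" and y: "y \<in> argmin_on C F"
    and uv: "0 \<le> u" "0 \<le> v" "u + v = 1"
  have "u *\<^sub>R x + v *\<^sub>R y \<in> C"
    using assms x y uv by (auto simp: argmin_on_def convex_on_def convex_def)
  moreover have "F (u *\<^sub>R x + v *\<^sub>R y) \<le> u * F x + v * F y"
    using assms x y uv by (auto simp: argmin_on_def convex_on_def)
  moreover have "F x = F y"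
    using x y by (auto simp: argmin_on_def intro: antisym)
  moreover have "u * F y + v * F y = F y"
    using uv by (metis distrib_right mult_1)
  ultimately show "u *\<^sub>R x + v *\<^sub>R y \<in> argmin_on C F"
    using x y by (auto simp: argmin_on_def intro: order_trans)
qed

text \<open>\<open>F\<close> is only lower semicontinuous on \<open>C\<close>, so the extreme value
  theorem for continuous functions does not apply. The lower level sets below \<open>F x0\<close>
  are compact and nested, and a point common to all of them is a minimizer.\<close>

lemma argmin_on_nonempty:
  fixes F :: "'a::euclidean_space \<Rightarrow> real"
  assumes cl: "closed (epigraph C F)" and x0: "x0 \<in> C"
    and bd: "bounded {x \<in> C. F x \<le> F x0}"
  shows "argmin_on C F \<noteq> {}"
proof -
  let ?I = "{y \<in> C. F y \<le> F x0}"
  let ?K = "\<lambda>y. {x \<in> C. F x \<le> F y}"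
  have "?I \<inter> (\<Inter>y\<in>?I. ?K y) \<noteq> {}"
  proof (rule compact_imp_fip_image)
    show "compact ?I"
      using closed_lower_level[OF cl] bd by (simp add: compact_eq_bounded_closed)
    show "\<And>y. y \<in> ?I \<Longrightarrow> closed (?K y)"
      by (rule closed_lower_level[OF cl])
    fix J assume J: "finite J" "J \<subseteq> ?I"
    show "?I \<inter> (\<Inter>y\<in>J. ?K y) \<noteq> {}"
    proof (cases "J = {}")
      case True
      then show ?thesis using x0 by auto
    next
      case False
      then have "Min (F ` J) \<in> F ` J"
        using J by (intro Min_in) auto
      then obtain y where y: "y \<in> J" "F y = Min (F ` J)" by auto
      have "F y \<le> F z" if "z \<in> J" for z
        using y that J by simp
      then show ?thesis using y J by blast
    qed
  qed
  then obtain x where x: "x \<in> ?I" "\<And>y. y \<in> ?I \<Longrightarrow> F x \<le> F y" by auto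
  then have "x \<in> argmin_on C F"
    unfolding argmin_on_def using order_trans by (smt (verit) mem_Collect_eq)
  then show ?thesis by auto
qed

text \<open>A sphere around a minimizer that encloses all minimizers carries a positive gap in
  value. Convexity along rays turns this gap into linear growth outside the sphere.\<close>

lemma bounded_lower_level:
  fixes F :: "'a::euclidean_space \<Rightarrow> real"
  assumes cv: "convex_on C F" and cl: "closed (epigraph C F)"
    and ne: "argmin_on C F \<noteq> {}" and bd: "bounded (argmin_on C F)"
  shows "bounded {x \<in> C. F x \<le> M}"
proof -
  obtain x0 where x0: "x0 \<in> argmin_on C F" using ne by auto
  obtain R where R: "R > 0" "argmin_on C F \<subseteq> ball x0 R"
    using bounded_subset_ballD[OF bd, of x0] by auto
  \<comment> \<open>By lower semicontinuity the minimum over the sphere is attained, and it exceeds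
    \<open>F x0\<close> since no minimizer lies on the sphere. If the sphere misses
    \<open>C\<close>, any positive gap will do.\<close>
  obtain \<delta> where \<delta>: "\<delta> > 0" "\<And>z. z \<in> C \<inter> sphere x0 R \<Longrightarrow> F x0 + \<delta> \<le> F z"
  proof (cases "C \<inter> sphere x0 R = {}")
    case True
    then show ?thesis using that[of 1] by auto
  next
    case False
    then obtain z1 where z1: "z1 \<in> C \<inter> sphere x0 R" by blast
    have "argmin_on (C \<inter> sphere x0 R) F \<noteq> {}"
      by (rule argmin_on_nonempty[OF closed_epigraph_Int[OF cl closed_sphere] z1])
         (auto intro: bounded_subset[OF bounded_sphere[of x0 R]])
    then obtain z0 where z0: "z0 \<in> argmin_on (C \<inter> sphere x0 R) F" by auto
    then have "z0 \<notin> argmin_on C F" "z0 \<in> C"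
      using R by (auto simp: argmin_on_def)
    then have "F x0 < F z0"
      using x0 by (auto simp: argmin_on_def not_le intro: order_trans)
    then show ?thesis
      using z0 by (intro that[of "F z0 - F x0"]) (auto simp: argmin_on_def)
  qed
  have "dist x0 x \<le> R + R * max 0 (M - F x0) / \<delta>" if x: "x \<in> C" "F x \<le> M" for x
  proof (cases "dist x0 x \<le> R")
    case True
    then show ?thesis using R \<delta> by (simp add: add_increasing2)
  next
    case False
    \<comment> \<open>This is the parameter at which the segment from \<open>x0\<close> to
      \<open>x\<close> crosses the sphere.\<close>
    define s where "s = R / dist x0 x"
    have pos: "dist x0 x > 0" using False R by linarith
    have s: "0 < s" "s < 1" using False R pos by (auto simp: s_def)
    define z where "z = (1 - s) *\<^sub>R x0 + s *\<^sub>R x"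
    have "z - x0 = s *\<^sub>R (x - x0)" by (simp add: z_def algebra_simps)
    then have "dist x0 z = s * dist x0 x"
      using s by (metis abs_of_pos dist_commute dist_norm norm_scaleR)
    then have "dist x0 z = R" using pos by (simp add: s_def)
    moreover have "x0 \<in> C" using x0 by (simp add: argmin_on_def)
    moreover have "z \<in> C"
      using cv x s \<open>x0 \<in> C\<close> unfolding z_def by (auto simp: convex_on_def convex_def)
    ultimately have "F x0 + \<delta> \<le> F z" using \<delta> by auto
    also have "F z \<le> (1 - s) * F x0 + s * F x"
      using cv x s \<open>x0 \<in> C\<close> unfolding z_def convex_on_def by auto
    finally have "\<delta> \<le> s * (F x - F x0)" by (simp add: algebra_simps)
    also have "\<dots> \<le> s * max 0 (M - F x0)"
      using s x by (intro mult_left_mono) auto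
    finally have "\<delta> * dist x0 x \<le> R * max 0 (M - F x0)"
      using pos by (simp add: s_def field_simps)
    then have "dist x0 x \<le> R * max 0 (M - F x0) / \<delta>"
      using \<delta> by (simp add: field_simps)
    then show ?thesis using R by linarith
  qed
  then have "{x \<in> C. F x \<le> M} \<subseteq> cball x0 (R + R * max 0 (M - F x0) / \<delta>)" by auto
  then show ?thesis using bounded_cball bounded_subset by blast
qed

section \<open>First-order conditions\<close>

text \<open>This is first-order optimality: \<open>- d\<close> is a subgradient of \<open>G\<close>
  at \<open>z\<close>. Minimality and convexity of \<open>G\<close> bound the difference quotients
  of \<open>h\<close> towards \<open>y\<close> from below by \<open>G z - G y\<close>; the limit
  from the right gives the claim.\<close>

lemma argmin_on_subgradient:
  fixes h G :: "'a::euclidean_space \<Rightarrow> real"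
  assumes z: "z \<in> argmin_on C (\<lambda>x. h x + G x)" and cv: "convex_on C G"
    and D: "GDERIV h z :> d" and y: "y \<in> C"
  shows "G z - d \<bullet> (y - z) \<le> G y"
proof -
  have zC: "z \<in> C" using z by (simp add: argmin_on_def)
  have line: "((\<lambda>s. z + s *\<^sub>R (y - z)) has_derivative (\<lambda>s. s *\<^sub>R (y - z))) (at (0::real))"
    by (auto intro!: derivative_eq_intros)
  have "((\<lambda>s. h (z + s *\<^sub>R (y - z))) has_derivative (\<lambda>s. (s *\<^sub>R (y - z)) \<bullet> d)) (at (0::real))"
    using has_derivative_compose[OF line, of h "\<lambda>v. v \<bullet> d"] D by (simp add: gderiv_def)
  then have "((\<lambda>s. h (z + s *\<^sub>R (y - z))) has_field_derivative d \<bullet> (y - z)) (at 0)"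
    by (simp add: has_field_derivative_def inner_commute mult.commute cong: if_cong)
       (simp add: mult_commute_abs)
  then have "((\<lambda>s. (h (z + s *\<^sub>R (y - z)) - h z) / s) \<longlongrightarrow> d \<bullet> (y - z)) (at 0)"
    by (simp add: has_field_derivative_iff)
  then have lim: "((\<lambda>s. (h (z + s *\<^sub>R (y - z)) - h z) / s) \<longlongrightarrow> d \<bullet> (y - z)) (at_right 0)"
    by (rule tendsto_mono[rotated]) (simp add: at_le)
  have "\<forall>\<^sub>F s in at_right 0. G z - G y \<le> (h (z + s *\<^sub>R (y - z)) - h z) / s"
    using eventually_at_right_real[of 0 1, OF zero_less_one]
  proof (rule eventually_mono)
    fix s :: real assume "s \<in> {0<..<1}"
    then have s: "0 < s" "s < 1" by auto
    have eq: "z + s *\<^sub>R (y - z) = (1 - s) *\<^sub>R z + s *\<^sub>R y" by (simp add: algebra_simps)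
    have "z + s *\<^sub>R (y - z) \<in> C"
      using cv zC y s unfolding eq by (auto simp: convex_on_def convex_def)
    then have "h z + G z \<le> h (z + s *\<^sub>R (y - z)) + G (z + s *\<^sub>R (y - z))"
      using z by (auto simp: argmin_on_def)
    also have "G (z + s *\<^sub>R (y - z)) \<le> (1 - s) * G z + s * G y"
      using cv zC y s unfolding eq convex_on_def by auto
    finally show "G z - G y \<le> (h (z + s *\<^sub>R (y - z)) - h z) / s"
      using s by (simp add: field_simps)
  qed
  then have "G z - G y \<le> d \<bullet> (y - z)"
    by (intro tendsto_lowerbound[OF lim]) auto
  then show ?thesis by simp
qed

lemma convex_on_gradient_ineq:
  fixes f :: "'a::euclidean_space \<Rightarrow> real"
  assumes "convex_on UNIV f" "GDERIV f z :> d"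
  shows "f z + d \<bullet> (y - z) \<le> f y"
proof -
  \<comment> \<open>every point minimizes \<open>- f + f\<close>\<close>
  have "z \<in> argmin_on UNIV (\<lambda>x. - f x + f x)" by (simp add: argmin_on_def)
  from argmin_on_subgradient[OF this assms(1) GDERIV_minus[OF assms(2)], of y]
  show ?thesis by simp
qed

section \<open>Linear regularity from the relative interior\<close>

text \<open>The nearest points \<open>p\<close> of \<open>A x\<close> and \<open>q\<close> of
  \<open>x\<close> have a residual \<open>p - A q\<close> of the order of the right-hand side.
  Mixing in, with a weight of the same order, a pair with opposite residual of length at most
  \<open>e\<close> makes the residual vanish. Boundedness of \<open>X\<close> and of the points of
  \<open>Q\<close> with small residual limits how far this moves \<open>q\<close>.\<close>

lemma bounded_linear_regularity:
  fixes A :: "'a::euclidean_space \<Rightarrow> 'b::euclidean_space"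
  assumes A: "linear A" and P: "convex P" "closed P" and Q: "convex Q" "closed Q"
    and ri: "0 \<in> rel_interior {p - A q | p q. p \<in> P \<and> q \<in> Q}"
    and bd: "\<And>e. bounded {q \<in> Q. \<exists>p\<in>P. norm (p - A q) \<le> e}"
    and X: "bounded X"
  shows "\<exists>\<kappa>>0. \<forall>x\<in>X.
    infdist x {q \<in> Q. A q \<in> P} \<le> \<kappa> * (infdist (A x) P + infdist x Q)"
proof -
  let ?D = "{p - A q | p q. p \<in> P \<and> q \<in> Q}"
  have "0 \<in> ?D" using ri rel_interior_subset by blast
  then obtain q0 where q0: "q0 \<in> Q" "A q0 \<in> P" by auto
  obtain e where e: "e > 0" "cball 0 e \<inter> affine hull ?D \<subseteq> ?D"
    using ri unfolding mem_rel_interior_cball by auto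
  obtain B where B: "B > 0" "X \<subseteq> ball q0 B"
    using bounded_subset_ballD[OF X, of q0] by auto
  obtain B' where B': "B' > 0" "{q \<in> Q. \<exists>p\<in>P. norm (p - A q) \<le> e} \<subseteq> ball q0 B'"
    using bounded_subset_ballD[OF bd[of e], of q0] by auto
  obtain a where a: "a > 0" "\<And>x. norm (A x) \<le> a * norm x"
    using linear_bounded_pos[OF A] by auto
  \<comment> \<open>The summand 1 pays for the way from \<open>x\<close> to \<open>q\<close>. The
    rest pays for the way from \<open>q\<close> to the corrected point: a weight of at most
    \<open>(1 + a) * d / e\<close> times a distance of at most \<open>2 * B + B'\<close>.\<close>
  define \<kappa> where "\<kappa> = 1 + (1 + a) * (2 * B + B') / e"
  have "infdist x {q \<in> Q. A q \<in> P} \<le> \<kappa> * (infdist (A x) P + infdist x Q)" if x: "x \<in> X" for x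
  proof -
    obtain p where p: "p \<in> P" "infdist (A x) P = dist (A x) p"
      using infdist_attains_inf[OF \<open>closed P\<close>, of "A x"] q0 by auto
    obtain q where q: "q \<in> Q" "infdist x Q = dist x q"
      using infdist_attains_inf[OF \<open>closed Q\<close>, of x] q0 by auto
    define u where "u = p - A q"
    define d where "d = infdist (A x) P + infdist x Q"
    have d0: "d \<ge> 0" by (simp add: d_def infdist_nonneg)
    have "u = (p - A x) + A (x - q)" by (simp add: u_def linear_diff[OF A])
    then have "norm u \<le> norm (p - A x) + norm (A (x - q))" by (metis norm_triangle_ineq)
    also have "\<dots> \<le> dist (A x) p + a * dist x q"
      using a(2)[of "x - q"] by (simp add: dist_norm norm_minus_commute)
    also have "\<dots> \<le> (1 + a) * d"
      using a by (simp add: d_def p q algebra_simps)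
    finally have u: "norm u \<le> (1 + a) * d" .
    \<comment> \<open>The weight solves \<open>(1 - s) * norm u = s * e\<close>, so that
      \<open>u\<close> and the opposite vector of length \<open>e\<close> cancel.\<close>
    define s where "s = norm u / (norm u + e)"
    have s: "0 \<le> s" "s \<le> 1" using e by (auto simp: s_def divide_le_eq_1 add_nonneg_pos)
    \<comment> \<open>For \<open>u = 0\<close> division by zero gives \<open>w = 0\<close>, and
      \<open>s = 0\<close>, so this case needs no separate construction.\<close>
    define w where "w = - (e / norm u) *\<^sub>R u"
    have uD: "u \<in> affine hull ?D" using p q by (intro hull_inc) (auto simp: u_def)
    \<comment> \<open>Since \<open>0\<close> lies in \<open>?D\<close>, the affine hull is a linear
      subspace and contains the negative multiple \<open>w\<close> of \<open>u\<close>.\<close>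
    have "affine hull ?D = span ?D"
      using \<open>0 \<in> ?D\<close> by (intro affine_hull_span_0 hull_inc)
    then have "w \<in> affine hull ?D" using uD by (simp add: w_def span_mul span_neg)
    moreover have "norm w \<le> e" using e by (simp add: w_def)
    ultimately have "w \<in> ?D" using e by auto
    then obtain p' q' where pq': "p' \<in> P" "q' \<in> Q" "w = p' - A q'" by auto
    have comb: "(1 - s) *\<^sub>R u + s *\<^sub>R w = 0"
    proof (cases "u = 0")
      case True
      then show ?thesis by (simp add: w_def)
    next
      case False
      then have "norm u > 0" "norm u + e > 0" using e by (auto intro: add_pos_pos)
      then have "(1 - s) = s * (e / norm u)"
        unfolding s_def by (simp add: divide_simps)
      then show ?thesis by (simp add: w_def)
    qed
    define x' where "x' = (1 - s) *\<^sub>R q + s *\<^sub>R q'"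
    have "x' \<in> Q"
      using Q q pq' s unfolding x'_def by (auto simp: convex_def)
    moreover have "A x' = (1 - s) *\<^sub>R (p - u) + s *\<^sub>R (p' - w)"
      by (simp add: x'_def linear_add[OF A] linear_scale[OF A] u_def pq')
    then have "A x' = (1 - s) *\<^sub>R p + s *\<^sub>R p' - ((1 - s) *\<^sub>R u + s *\<^sub>R w)"
      by (simp add: scaleR_right_diff_distrib)
    then have "A x' = (1 - s) *\<^sub>R p + s *\<^sub>R p'"
      by (simp only: comb diff_zero)
    then have "A x' \<in> P"
      using P p pq' s by (auto simp: convex_def)
    ultimately have "infdist x {q \<in> Q. A q \<in> P} \<le> dist x x'"
      by (intro infdist_le) auto
    also have "\<dots> \<le> dist x q + dist q x'" by (rule dist_triangle)
    also have "q - x' = s *\<^sub>R (q - q')" by (simp add: x'_def algebra_simps)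
    then have "dist q x' = s * dist q q'" using s by (simp add: dist_norm)
    also have "s * dist q q' \<le> ((1 + a) * d / e) * (2 * B + B')"
    proof (rule mult_mono)
      have "s \<le> norm u / e" using e by (simp add: s_def frac_le)
      also have "\<dots> \<le> (1 + a) * d / e" using u e by (simp add: divide_right_mono)
      finally show "s \<le> (1 + a) * d / e" .
      have "q' \<in> ball q0 B'" using B' pq' \<open>norm w \<le> e\<close> by auto
      moreover have "dist q0 x < B" using B x by auto
      moreover have "dist x q \<le> dist x q0"
        using q(2) infdist_le[OF q0(1), of x] by simp
      ultimately show "dist q q' \<le> 2 * B + B'"
        using dist_triangle[of q q' q0] dist_triangle[of q q0 x]
        by (simp add: dist_commute)
    qed (use e d0 a in auto)
    also have "dist x q \<le> d" by (simp add: d_def q infdist_nonneg)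
    finally have "infdist x {q \<in> Q. A q \<in> P} \<le> d + (1 + a) * d / e * (2 * B + B')" by simp
    also have "\<dots> = \<kappa> * d" using e by (simp add: \<kappa>_def field_simps)
    finally show ?thesis unfolding d_def .
  qed
  moreover have "\<kappa> > 0" using a B B' e by (simp add: \<kappa>_def add_pos_nonneg)
  ultimately show ?thesis by blast
qed

section \<open>Quadratic growth and conjugates of extended functions\<close>

text \<open>The value at an arbitrary minimizer stands for the infimum, which keeps the inequality
  real-valued. Without minimizers the property is vacuous.\<close>

definition quadratic_growth :: "'a::euclidean_space set \<Rightarrow> ('a \<Rightarrow> real) \<Rightarrow> bool" where
  "quadratic_growth C F \<longleftrightarrow>
     (\<forall>X. bounded X \<longrightarrow> (\<exists>\<alpha>>0. \<forall>x\<in>X \<inter> C. \<forall>z\<in>argmin_on C F.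
        F z + \<alpha> * (infdist x (argmin_on C F))\<^sup>2 \<le> F x))"

text \<open>A proper function is represented by its effective domain and a real-valued function on
  it, so that most arguments stay in the reals.\<close>

definition extended :: "'a set \<Rightarrow> ('a \<Rightarrow> real) \<Rightarrow> 'a \<Rightarrow> ereal" where
  "extended C G x = (if x \<in> C then ereal (G x) else \<infinity>)"

abbreviation tilt :: "('a::real_inner \<Rightarrow> real) \<Rightarrow> 'a \<Rightarrow> 'a \<Rightarrow> real" where
  "tilt G v x \<equiv> G x - v \<bullet> x"

text \<open>This is the Fenchel-Young inequality; the next lemma is its equality case.\<close>

lemma fenchel_conjugate_extended_ge:
  assumes "x \<in> C"
  shows "ereal (- tilt G v x) \<le> fenchel_conjugate (extended C G) v"
  unfolding fenchel_conjugate_def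
  by (rule SUP_upper2[of x]) (use assms in \<open>auto simp: extended_def\<close>)

lemma fenchel_conjugate_extended_eq:
  assumes "x \<in> argmin_on C (tilt G v)"
  shows "fenchel_conjugate (extended C G) v = ereal (- tilt G v x)"
proof (rule antisym)
  show "fenchel_conjugate (extended C G) v \<le> ereal (- tilt G v x)"
    unfolding fenchel_conjugate_def
    by (rule SUP_least) (use assms in \<open>auto simp: extended_def argmin_on_def algebra_simps\<close>)
  show "ereal (- tilt G v x) \<le> fenchel_conjugate (extended C G) v"
    using assms by (intro fenchel_conjugate_extended_ge) (auto simp: argmin_on_def)
qed

section \<open>The composite problem, its shifts and its dual\<close>

locale composite_problem =
  fixes f :: "'b::euclidean_space \<Rightarrow> real" and df :: "'b \<Rightarrow> 'b"
    and G :: "'a::euclidean_space \<Rightarrow> real" and C :: "'a set" and A :: "'a \<Rightarrow> 'b"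
  assumes convex_f: "convex_on UNIV f"
    and grad_f: "\<And>y. GDERIV f y :> df y"
    and convex_G: "convex_on C G"
    and closed_G: "closed (epigraph C G)"
    and linear_A: "linear A"
begin

text \<open>The shift \<open>w\<close> is the perturbation parameter of Fenchel-Rockafellar duality;
  \<open>w = 0\<close> gives the primal objective on \<open>C\<close>.\<close>

definition perturbed :: "'b \<Rightarrow> 'a \<Rightarrow> real" where
  "perturbed w x = f (A x + w) + G x"

abbreviation "solutions \<equiv> argmin_on C (perturbed 0)"

lemma inner_image_adjoint: "y \<bullet> A z = adjoint A y \<bullet> z"
  by (metis adjoint_works[OF linear_A] inner_commute)

lemma continuous_f: "continuous_on T f"
  using grad_f unfolding gderiv_def
  by (meson continuous_at_imp_continuous_on has_derivative_continuous)

lemma continuous_f_affine: "continuous_on T (\<lambda>x. f (A x + w))"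
  by (intro continuous_on_compose2[OF continuous_f[of UNIV]] continuous_intros
      linear_continuous_on_compose[OF _ linear_A]) auto

lemma convex_perturbed: "convex_on C (perturbed w)"
proof -
  have "convex_on C (\<lambda>x. f (A x + w))"
    unfolding convex_on_def
  proof (intro conjI ballI allI impI)
    fix x y and u v :: real assume uv: "0 \<le> u" "0 \<le> v" "u + v = 1"
    have "A (u *\<^sub>R x + v *\<^sub>R y) + w = u *\<^sub>R (A x + w) + v *\<^sub>R (A y + w)"
      using uv by (simp add: linear_add[OF linear_A] linear_scale[OF linear_A] algebra_simps
          flip: scaleR_left_distrib)
    then show "f (A (u *\<^sub>R x + v *\<^sub>R y) + w) \<le> u * f (A x + w) + v * f (A y + w)"
      using convex_f uv unfolding convex_on_def by auto
  qed (use convex_G in \<open>simp add: convex_on_def\<close>)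
  then show ?thesis
    unfolding perturbed_def using convex_G by (intro convex_on_add) 
qed

lemma closed_perturbed: "closed (epigraph C (perturbed w))"
  unfolding perturbed_def by (intro closed_epigraph_add closed_G continuous_f_affine)

lemma perturbed_gradient: "GDERIV (\<lambda>x. f (A x + w)) x :> adjoint A (df (A x + w))"
proof -
  have "((\<lambda>x. A x + w) has_derivative A) (at x)"
    using linear_A by (auto intro!: derivative_eq_intros linear_imp_has_derivative)
  from has_derivative_compose[OF this, of f "\<lambda>h. h \<bullet> df (A x + w)"]
  show ?thesis
    using grad_f by (simp add: gderiv_def adjoint_works[OF linear_A])
qed

text \<open>The gradient of \<open>f\<close> at a solution is a dual multiplier. The gradient
  inequality shows that the tilted \<open>f\<close> is minimized, and first-order optimality shows
  it for the tilted \<open>G\<close>.\<close>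

lemma perturbed_argmin_dual:
  assumes x: "x \<in> argmin_on C (perturbed w)"
  defines "y \<equiv> df (A x + w)"
  shows "A x + w \<in> argmin_on UNIV (tilt f y)" "x \<in> argmin_on C (tilt G (- adjoint A y))"
proof -
  show "A x + w \<in> argmin_on UNIV (tilt f y)"
    using convex_on_gradient_ineq[OF convex_f grad_f[of "A x + w"]]
    by (auto simp: argmin_on_def y_def algebra_simps inner_diff_right)
  show "x \<in> argmin_on C (tilt G (- adjoint A y))"
    using argmin_on_subgradient[OF x[unfolded perturbed_def] convex_G perturbed_gradient] x
    by (auto simp: argmin_on_def y_def algebra_simps inner_diff_right)
qed

text \<open>The tilts at \<open>A x + w\<close> and \<open>x\<close> sum to
  \<open>perturbed w x - y \<bullet> w\<close>, because the terms in \<open>y \<bullet> A x\<close>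
  cancel. With \<open>w = p - A q\<close> both tilts are minimal at \<open>x = q\<close>.\<close>

lemma argmin_tilts_perturbed:
  assumes "p \<in> argmin_on UNIV (tilt f y)" "q \<in> argmin_on C (tilt G (- adjoint A y))"
  shows "q \<in> argmin_on C (perturbed (p - A q))"
  unfolding argmin_on_def
proof (safe)
  show "q \<in> C" using assms by (simp add: argmin_on_def)
  fix x assume x: "x \<in> C"
  have "tilt f y p \<le> tilt f y (A x + (p - A q))"
    using assms by (simp add: argmin_on_def)
  moreover have "tilt G (- adjoint A y) q \<le> tilt G (- adjoint A y) x"
    using assms x by (simp add: argmin_on_def)
  ultimately show "perturbed (p - A q) q \<le> perturbed (p - A q) x"
    by (simp add: perturbed_def inner_image_adjoint algebra_simps)
qed

end

locale bounded_composite_problem = composite_problem f df G C A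
  for f :: "'b::euclidean_space \<Rightarrow> real" and df :: "'b \<Rightarrow> 'b"
    and G :: "'a::euclidean_space \<Rightarrow> real" and C :: "'a set" and A :: "'a \<Rightarrow> 'b" +
  assumes solutions_nonempty: "solutions \<noteq> {}"
    and solutions_bounded: "bounded solutions"
begin

lemma bounded_solutions_lower_level: "bounded {x \<in> C. perturbed 0 x \<le> M}"
  by (intro bounded_lower_level convex_perturbed closed_perturbed solutions_nonempty solutions_bounded)

text \<open>The midpoint of such an \<open>x\<close> with \<open>x0\<close> lies in one fixed lower
  level set of the unshifted problem, which is bounded. The bound is uniform in the shift.\<close>

lemma bounded_perturbed_lower_levels:
  assumes x0: "x0 \<in> C"
  shows "bounded (\<Union>w\<in>cball 0 e. {x \<in> C. perturbed w x \<le> perturbed w x0})"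
proof -
  have "compact ((\<lambda>w. f (A x0 + w)) ` cball 0 e)"
    by (intro compact_continuous_image continuous_on_compose2[OF continuous_f[of UNIV]]
        continuous_intros) auto
  then obtain K where "\<forall>w\<in>cball 0 e. norm (f (A x0 + w)) \<le> K"
    by (auto dest!: compact_imp_bounded simp: bounded_iff)
  then have K: "norm (f (A x0 + w)) \<le> K" if "norm w \<le> e" for w
    using that by simp
  obtain B where B: "\<And>z. z \<in> C \<Longrightarrow> perturbed 0 z \<le> K + G x0 \<Longrightarrow> norm z \<le> B"
    using bounded_solutions_lower_level[of "K + G x0"] by (auto simp: bounded_iff)
  have "norm x \<le> 2 * B + norm x0"
    if w: "norm w \<le> e" and x: "x \<in> C" "perturbed w x \<le> perturbed w x0" for w x
  proof -
    define z where "z = (1/2) *\<^sub>R x + (1/2) *\<^sub>R x0"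
    have "z \<in> C"
      using convexD[of C x x0 "1/2" "1/2"] convex_G x x0 unfolding z_def convex_on_def by auto
    have "G z \<le> (1/2) * G x + (1/2) * G x0"
      using convex_onD[OF convex_G, of "1/2" x x0] x x0 unfolding z_def by simp
    \<comment> \<open>The shifts \<open>w\<close> and \<open>- w\<close> cancel at the midpoint, so
      \<open>f\<close> at \<open>A z\<close> is controlled by the shifted value at \<open>x\<close>
      and by a value bounded through \<open>K\<close>.\<close>
    moreover have Az: "A z + 0 = (1/2) *\<^sub>R (A x + w) + (1/2) *\<^sub>R (A x0 + - w)"
      by (simp add: z_def linear_add[OF linear_A] linear_scale[OF linear_A] algebra_simps)
    have "f (A z + 0) \<le> (1/2) * f (A x + w) + (1/2) * f (A x0 + - w)"
      using convex_onD[OF convex_f, of "1/2" "A x + w" "A x0 + - w"] unfolding Az by simp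
    moreover have "norm (f (A x0 + w)) \<le> K" "norm (f (A x0 + - w)) \<le> K"
      using K[of w] K[of "- w"] w by simp_all
    ultimately have "perturbed 0 z \<le> K + G x0"
      using x(2) unfolding perturbed_def real_norm_def by linarith
    then have "norm z \<le> B" using B \<open>z \<in> C\<close> by blast
    moreover have "x = 2 *\<^sub>R z - x0" by (simp add: z_def algebra_simps)
    ultimately show ?thesis using norm_triangle_ineq4[of "2 *\<^sub>R z" x0] by simp
  qed
  then show ?thesis unfolding bounded_iff by (intro exI[of _ "2 * B + norm x0"]) auto
qed

lemma perturbed_attained: "argmin_on C (perturbed w) \<noteq> {}"
proof -
  obtain x0 where x0: "x0 \<in> C" using solutions_nonempty by (auto simp: argmin_on_def)
  have "bounded {x \<in> C. perturbed w x \<le> perturbed w x0}"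
    by (rule bounded_subset[OF bounded_perturbed_lower_levels[OF x0, of "norm w"]]) auto
  then show ?thesis by (rule argmin_on_nonempty[OF closed_perturbed x0])
qed

text \<open>
  For \<open>w\<close> in the subdifferential, a solution \<open>x\<close> of the problem shifted by \<open>w\<close> provides the
  decomposition \<open>w = (A x + w) - A x\<close>, by equality in the Fenchel-Young inequalities.
\<close>

lemma subdifferential_dual:
  fixes ybar
  defines "P \<equiv> argmin_on UNIV (tilt f ybar)"
    and "Q \<equiv> argmin_on C (tilt G (- adjoint A ybar))"
  shows "subdifferential (dual_obj f (extended C G) A) ybar = {p - A q | p q. p \<in> P \<and> q \<in> Q}"
proof -
  have ff: "(\<lambda>z. ereal (f z)) = extended UNIV f" by (simp add: extended_def fun_eq_iff)
  have dual_ge: "ereal (y \<bullet> (z - A x) - f z - G x) \<le> dual_obj f (extended C G) A y"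
    if "x \<in> C" for x y z
  proof -
    have "ereal (- tilt f y z) + ereal (- tilt G (- adjoint A y) x) \<le> dual_obj f (extended C G) A y"
      unfolding dual_obj_def ff using that by (intro add_mono fenchel_conjugate_extended_ge) auto
    then show ?thesis by (simp add: algebra_simps inner_image_adjoint)
  qed
  have dual_eq: "dual_obj f (extended C G) A y = ereal (y \<bullet> (p - A q) - f p - G q)"
    if "p \<in> argmin_on UNIV (tilt f y)" "q \<in> argmin_on C (tilt G (- adjoint A y))" for p q y
    unfolding dual_obj_def ff fenchel_conjugate_extended_eq[OF that(1)]
      fenchel_conjugate_extended_eq[OF that(2)]
    by (simp add: algebra_simps inner_image_adjoint)
  show ?thesis
  proof (intro subset_antisym subsetI)
    fix w assume "w \<in> {p - A q | p q. p \<in> P \<and> q \<in> Q}"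
    then obtain p q where w: "w = p - A q" and p: "p \<in> P" and q: "q \<in> Q" by auto
    have "q \<in> C" using q by (simp add: Q_def argmin_on_def)
    \<comment> \<open>The pair \<open>p\<close>, \<open>q\<close> gives an affine minorant of the
      dual objective with slope \<open>p - A q\<close>, and it is exact at
      \<open>ybar\<close>.\<close>
    from dual_ge[OF this, of _ p] show "w \<in> subdifferential (dual_obj f (extended C G) A) ybar"
      unfolding subdifferential_def dual_eq[OF p[unfolded P_def] q[unfolded Q_def]] w
      by (simp add: inner_diff_right inner_commute algebra_simps)
  next
    fix w assume w: "w \<in> subdifferential (dual_obj f (extended C G) A) ybar"
    obtain x where x: "x \<in> argmin_on C (perturbed w)" using perturbed_attained by blast
    have xC: "x \<in> C" using x by (simp add: argmin_on_def)
    define y where "y = df (A x + w)"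
    have yw: "dual_obj f (extended C G) A y = ereal (y \<bullet> w - f (A x + w) - G x)"
      using dual_eq[OF perturbed_argmin_dual[OF x]] by (simp add: y_def)
    \<comment> \<open>This is the subgradient inequality from \<open>ybar\<close> to
      \<open>y\<close>, where the dual value at \<open>y\<close> is known exactly.\<close>
    have key: "ybar \<bullet> (z - A x') - f z - G x' + w \<bullet> (y - ybar) \<le> y \<bullet> w - f (A x + w) - G x"
      if "x' \<in> C" for z x'
    proof -
      have "ereal (ybar \<bullet> (z - A x') - f z - G x') + ereal (w \<bullet> (y - ybar))
          \<le> dual_obj f (extended C G) A ybar + ereal (w \<bullet> (y - ybar))"
        using dual_ge[OF that] by (rule add_right_mono)
      also have "\<dots> \<le> dual_obj f (extended C G) A y"
        using w by (simp add: subdifferential_def)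
      finally show ?thesis by (simp add: yw)
    qed
    \<comment> \<open>In \<open>key\<close>, the choice \<open>x' = x\<close> cancels the terms in
      \<open>G\<close> and leaves minimality for the tilted \<open>f\<close>. The choice
      \<open>z = A x + w\<close> below leaves minimality for the tilted \<open>G\<close>.\<close>
    have "A x + w \<in> P"
      unfolding P_def argmin_on_def
      using key[OF xC] by (auto simp: inner_diff_right inner_commute algebra_simps)
    moreover have "x \<in> Q"
      unfolding Q_def argmin_on_def
      using key[of _ "A x + w"] xC
      by (auto simp: inner_diff_right inner_commute algebra_simps inner_image_adjoint)
    ultimately have "\<exists>p q. w = p - A q \<and> p \<in> P \<and> q \<in> Q"
      by (intro exI[of _ "A x + w"] exI[of _ x]) simp
    then show "w \<in> {p - A q | p q. p \<in> P \<and> q \<in> Q}" by simp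
  qed
qed

text \<open>The objective is the sum of the two tilts at \<open>A x\<close> and \<open>x\<close>,
  which grow with the squared distances to \<open>P\<close> and \<open>Q\<close>. Linear regularity
  bounds the distance to the solutions by the sum of these distances.\<close>

lemma quadratic_growth_solutions:
  assumes ri: "0 \<in> rel_interior (subdifferential (dual_obj f (extended C G) A) ybar)"
    and gf: "quadratic_growth UNIV (tilt f ybar)"
    and gG: "quadratic_growth C (tilt G (- adjoint A ybar))"
  shows "quadratic_growth C (perturbed 0)"
proof -
  define P where "P = argmin_on UNIV (tilt f ybar)"
  define Q where "Q = argmin_on C (tilt G (- adjoint A ybar))"
  have ri': "0 \<in> rel_interior {p - A q | p q. p \<in> P \<and> q \<in> Q}"
    using ri unfolding subdifferential_dual P_def Q_def .
  then have "0 \<in> {p - A q | p q. p \<in> P \<and> q \<in> Q}"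
    using rel_interior_subset by blast
  then obtain q0 where q0: "q0 \<in> Q" "A q0 \<in> P" by auto
  have conv_tilt: "convex_on T (tilt F v)" if "convex_on T F"
    for T v and F :: "'c::euclidean_space \<Rightarrow> real"
    using that by (auto simp: convex_on_def algebra_simps inner_add_right)
  have cont: "continuous_on UNIV (\<lambda>x. - (v \<bullet> x))" for v :: "'c::euclidean_space"
    by (intro continuous_intros)
  have clP: "closed P"
    unfolding P_def
    by (intro closed_argmin_on closed_epigraph_UNIV continuous_intros continuous_f)
  have clQ: "closed Q"
    unfolding Q_def
    using closed_epigraph_add[OF closed_G cont[of "- adjoint A ybar"]]
    by (intro closed_argmin_on) (simp add: add.commute)
  have cvP: "convex P" and cvQ: "convex Q"
    unfolding P_def Q_def by (intro convex_argmin_on conv_tilt convex_f convex_G)+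
  \<comment> \<open>As \<open>q0\<close> minimizes both tilts at once, a minimizer of their sum must
    minimize each of them.\<close>
  have sol: "solutions = {q \<in> Q. A q \<in> P}"
  proof (intro subset_antisym subsetI)
    fix q assume "q \<in> {q \<in> Q. A q \<in> P}"
    then show "q \<in> solutions"
      using argmin_tilts_perturbed[of "A q" ybar q] by (simp add: P_def Q_def)
  next
    fix q assume q: "q \<in> solutions"
    have qC: "q \<in> C" "q0 \<in> C" using q q0 by (auto simp: argmin_on_def Q_def)
    then have "perturbed 0 q \<le> perturbed 0 q0" using q by (auto simp: argmin_on_def)
    then have le: "tilt f ybar (A q) + tilt G (- adjoint A ybar) q
        \<le> tilt f ybar (A q0) + tilt G (- adjoint A ybar) q0"
      by (simp add: perturbed_def inner_image_adjoint)
    have 1: "tilt f ybar (A q0) \<le> tilt f ybar z" for z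
      using q0 by (auto simp: P_def argmin_on_def)
    have 2: "tilt G (- adjoint A ybar) q0 \<le> tilt G (- adjoint A ybar) x" if "x \<in> C" for x
      using q0 that by (auto simp: Q_def argmin_on_def)
    have "tilt f ybar (A q) \<le> tilt f ybar z" for z
      using le 1[of z] 2[OF qC(1)] by linarith
    moreover have "tilt G (- adjoint A ybar) q \<le> tilt G (- adjoint A ybar) x" if "x \<in> C" for x
      using le 1[of "A q"] 2[OF that] by linarith
    ultimately show "q \<in> {q \<in> Q. A q \<in> P}"
      using qC by (simp add: P_def Q_def argmin_on_def)
  qed
  \<comment> \<open>Each such \<open>q\<close> solves the problem shifted by \<open>p - A q\<close>,
    so the uniform bound over shifts of norm at most \<open>e\<close> applies.\<close>
  have bd: "bounded {q \<in> Q. \<exists>p\<in>P. norm (p - A q) \<le> e}" for e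
  proof (rule bounded_subset[OF bounded_perturbed_lower_levels[of q0 e]])
    show "q0 \<in> C" using q0 by (simp add: Q_def argmin_on_def)
    show "{q \<in> Q. \<exists>p\<in>P. norm (p - A q) \<le> e}
        \<subseteq> (\<Union>w\<in>cball 0 e. {x \<in> C. perturbed w x \<le> perturbed w q0})"
    proof safe
      fix p q assume p: "p \<in> P" and q: "q \<in> Q" and e: "norm (p - A q) \<le> e"
      have "q \<in> argmin_on C (perturbed (p - A q))"
        using argmin_tilts_perturbed p q unfolding P_def Q_def .
      then have "q \<in> C" "perturbed (p - A q) q \<le> perturbed (p - A q) q0"
        using \<open>q0 \<in> C\<close> by (auto simp: argmin_on_def)
      with e show "q \<in> (\<Union>w\<in>cball 0 e. {x \<in> C. perturbed w x \<le> perturbed w q0})"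
        by (intro UN_I[of "p - A q"]) auto
    qed
  qed
  show ?thesis
    unfolding quadratic_growth_def
  proof (intro allI impI)
    fix X :: "'a set" assume X: "bounded X"
    obtain \<kappa> where \<kappa>: "\<kappa> > 0"
      "\<forall>x\<in>X. infdist x solutions \<le> \<kappa> * (infdist (A x) P + infdist x Q)"
      using bounded_linear_regularity[OF linear_A cvP clP cvQ clQ ri' bd X] unfolding sol by blast
    have AX: "bounded (A ` X)"
      using X linear_A by (simp add: bounded_linear_image linear_linear)
    obtain \<alpha> where \<alpha>: "\<alpha> > 0"
      "\<forall>z\<in>A ` X \<inter> UNIV. \<forall>p\<in>P. tilt f ybar p + \<alpha> * (infdist z P)\<^sup>2 \<le> tilt f ybar z"
      using gf AX unfolding quadratic_growth_def P_def by blast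
    obtain \<beta> where \<beta>: "\<beta> > 0"
      "\<forall>x\<in>X \<inter> C. \<forall>q\<in>Q. tilt G (- adjoint A ybar) q + \<beta> * (infdist x Q)\<^sup>2
        \<le> tilt G (- adjoint A ybar) x"
      using gG X unfolding quadratic_growth_def Q_def by blast
    \<comment> \<open>The factor 2 comes from \<open>(a + b)^2 \<le> 2 * (a^2 + b^2)\<close> and the
      square of \<open>\<kappa>\<close> from regularity.\<close>
    define \<mu> where "\<mu> = min \<alpha> \<beta> / (2 * \<kappa>\<^sup>2)"
    have "perturbed 0 z + \<mu> * (infdist x solutions)\<^sup>2 \<le> perturbed 0 x"
      if x: "x \<in> X" "x \<in> C" and z: "z \<in> solutions" for x z
    proof -
      let ?a = "infdist (A x) P" and ?b = "infdist x Q"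
      have "(infdist x solutions)\<^sup>2 \<le> (\<kappa> * (?a + ?b))\<^sup>2"
        using \<kappa>(2) x(1) by (intro power_mono infdist_nonneg) blast
      also have "\<dots> = \<kappa>\<^sup>2 * (?a + ?b)\<^sup>2" by (simp add: power_mult_distrib)
      also have "(?a + ?b)\<^sup>2 \<le> 2 * (?a\<^sup>2 + ?b\<^sup>2)"
        using sum_squares_bound[of ?a ?b] by (simp add: power2_sum)
      finally have "\<mu> * (infdist x solutions)\<^sup>2 \<le> \<mu> * (\<kappa>\<^sup>2 * (2 * (?a\<^sup>2 + ?b\<^sup>2)))"
        using \<alpha> \<beta> \<kappa> by (intro mult_left_mono) (auto simp: \<mu>_def mult_left_mono)
      also have "\<dots> = min \<alpha> \<beta> * ?a\<^sup>2 + min \<alpha> \<beta> * ?b\<^sup>2"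
        using \<kappa> by (simp add: \<mu>_def field_simps)
      also have "\<dots> \<le> \<alpha> * ?a\<^sup>2 + \<beta> * ?b\<^sup>2"
        by (intro add_mono mult_right_mono) auto
      finally have "\<mu> * (infdist x solutions)\<^sup>2 \<le> \<alpha> * ?a\<^sup>2 + \<beta> * ?b\<^sup>2" .
      moreover have "tilt f ybar (A z) + \<alpha> * ?a\<^sup>2 \<le> tilt f ybar (A x)"
        using z x by (intro \<alpha>(2)[rule_format]) (auto simp: sol)
      moreover have "tilt G (- adjoint A ybar) z + \<beta> * ?b\<^sup>2 \<le> tilt G (- adjoint A ybar) x"
        using z x by (intro \<beta>(2)[rule_format]) (auto simp: sol)
      ultimately show ?thesis by (simp add: perturbed_def inner_image_adjoint)
    qed
    moreover have "\<mu> > 0" using \<alpha> \<beta> \<kappa> by (simp add: \<mu>_def)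
    ultimately show "\<exists>\<alpha>>0. \<forall>x\<in>X \<inter> C. \<forall>z\<in>solutions.
        perturbed 0 z + \<alpha> * (infdist x solutions)\<^sup>2 \<le> perturbed 0 x"
      by blast
  qed
qed

text \<open>A long step is trivial, since \<open>x\<close> stays in a bounded lower level set. After
  a short step, \<open>u\<close> lies in the fixed ball on which the growth constant is valid; there
  the gap in value is at most \<open>k * norm v\<close> times the distance to the nearest solution
  and at least \<open>\<alpha>\<close> times its square.\<close>

lemma error_bound_of_quadratic_growth:
  assumes lip: "L-lipschitz_on UNIV df" and growth: "quadratic_growth C (perturbed 0)" and t: "t > 0"
  shows "\<exists>\<gamma>>0. \<forall>x\<in>C. perturbed 0 x \<le> M \<longrightarrow>
    (\<forall>u\<in>argmin_on C (\<lambda>y. 1 / (2 * t) * (norm (y - (x - t *\<^sub>R adjoint A (df (A x)))))\<^sup>2 + G y).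
      infdist x solutions \<le> \<gamma> * norm ((1 / t) *\<^sub>R (x - u)))"
proof -
  obtain x0 where x0: "x0 \<in> solutions" using solutions_nonempty by auto
  obtain B where B: "B > 0" "{x \<in> C. perturbed 0 x \<le> M} \<subseteq> ball x0 B"
    using bounded_subset_ballD[OF bounded_solutions_lower_level] by blast
  obtain \<alpha> where \<alpha>: "\<alpha> > 0"
    "\<forall>x\<in>cball x0 (B + t) \<inter> C. \<forall>z\<in>solutions.
      perturbed 0 z + \<alpha> * (infdist x solutions)\<^sup>2 \<le> perturbed 0 x"
    using growth bounded_cball unfolding quadratic_growth_def by blast
  obtain a where a: "a > 0" "\<And>x. norm (A x) \<le> a * norm x"
    using linear_bounded_pos[OF linear_A] by auto
  have L: "L \<ge> 0" using lip by (simp add: lipschitz_on_def)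
  \<comment> \<open>The summand 1 comes from the step \<open>v\<close> itself;
    \<open>L * a\<^sup>2 * t\<close> comes from the change of the gradient between \<open>x\<close>
    and \<open>u\<close>, where \<open>norm (x - u) = t * norm v\<close>.\<close>
  define k where "k = 1 + L * a\<^sup>2 * t"
  have k: "k > 0" using L a t by (simp add: k_def add_pos_nonneg)
  \<comment> \<open>\<open>B\<close> covers long steps, \<open>t\<close> the way from
    \<open>x\<close> to \<open>u\<close>, and \<open>k / \<alpha>\<close> the way from
    \<open>u\<close> to the solutions.\<close>
  define \<gamma> where "\<gamma> = B + t + k / \<alpha>"
  have "infdist x solutions \<le> \<gamma> * norm ((1 / t) *\<^sub>R (x - u))"
    if x: "x \<in> C" "perturbed 0 x \<le> M"
      and u: "u \<in> argmin_on C (\<lambda>y. 1 / (2 * t) * (norm (y - (x - t *\<^sub>R adjoint A (df (A x)))))\<^sup>2 + G y)"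
    for x u
  proof -
    define v where "v = (1 / t) *\<^sub>R (x - u)"
    have xu: "x - u = t *\<^sub>R v" using t by (simp add: v_def)
    have xB: "dist x0 x \<le> B" using x B by force
    show ?thesis
    proof (cases "norm v \<ge> 1")
      case True
      have "infdist x solutions \<le> B * 1"
        using infdist_le[OF x0, of x] xB by (simp add: dist_commute)
      also have "\<dots> \<le> \<gamma> * norm v"
        using True B t k \<alpha> by (intro mult_mono) (auto simp: \<gamma>_def)
      finally show ?thesis by (simp add: v_def)
    next
      case False
      have uC: "u \<in> C" using u by (simp add: argmin_on_def)
      have "dist x u = t * norm v" using xu t by (simp add: dist_norm)
      then have dxu: "dist x u \<le> t" using False t by simp
      then have "u \<in> cball x0 (B + t)"
        using xB dist_triangle[of x0 u x] by simp
      with \<alpha>(2) uC have grow: "perturbed 0 z + \<alpha> * (infdist u solutions)\<^sup>2 \<le> perturbed 0 u"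
        if "z \<in> solutions" for z
        using that by blast
      obtain z where z: "z \<in> solutions" "infdist u solutions = dist u z"
        using infdist_attains_inf[OF closed_argmin_on[OF closed_perturbed] solutions_nonempty] by metis
      have zC: "z \<in> C" using z by (simp add: argmin_on_def)
      define b where "b = x - t *\<^sub>R adjoint A (df (A x))"
      have "((\<lambda>y. 1 / (2 * t) * ((y - b) \<bullet> (y - b))) has_derivative
          (\<lambda>h. h \<bullet> ((1 / t) *\<^sub>R (u - b)))) (at u)"
        using t by (auto intro!: derivative_eq_intros simp: fun_eq_iff inner_commute divide_simps)
      then have "GDERIV (\<lambda>y. 1 / (2 * t) * (norm (y - b))\<^sup>2) u :> (1 / t) *\<^sub>R (u - b)"
        by (simp add: gderiv_def power2_norm_eq_inner)
      from argmin_on_subgradient[OF u[folded b_def] convex_G this zC]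
      have "G u - ((1 / t) *\<^sub>R (u - b)) \<bullet> (z - u) \<le> G z" .
      moreover have "(1 / t) *\<^sub>R (u - b) = adjoint A (df (A x)) - v"
        using t by (simp add: b_def v_def algebra_simps)
      moreover have "adjoint A (df (A x)) \<bullet> (z - u) = df (A x) \<bullet> (A z - A u)"
        by (simp add: inner_image_adjoint flip: linear_diff[OF linear_A])
      \<comment> \<open>The gradient inequality is taken at \<open>A u\<close>, while the prox step
        uses the gradient at \<open>A x\<close>; the Lipschitz bound handles the difference.\<close>
      moreover have "f (A u) + df (A u) \<bullet> (A z - A u) \<le> f (A z)"
        by (rule convex_on_gradient_ineq[OF convex_f grad_f])
      ultimately have "perturbed 0 u - perturbed 0 z
          \<le> (df (A x) - df (A u)) \<bullet> (A z - A u) - v \<bullet> (z - u)"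
        by (simp add: perturbed_def inner_diff_left)
      also have "\<dots> \<le> norm (df (A x) - df (A u)) * norm (A z - A u) + norm v * norm (z - u)"
        using norm_cauchy_schwarz[of "df (A x) - df (A u)" "A z - A u"]
          norm_cauchy_schwarz[of "- v" "z - u"] by simp
      also have "norm (df (A x) - df (A u)) * norm (A z - A u)
          \<le> (L * (a * norm (x - u))) * (a * norm (z - u))"
      proof (rule mult_mono)
        have "norm (df (A x) - df (A u)) \<le> L * norm (A x - A u)"
          using lipschitz_onD[OF lip, of "A x" "A u"] by (simp add: dist_norm)
        also have "\<dots> \<le> L * (a * norm (x - u))"
          using a(2)[of "x - u"] L by (intro mult_left_mono) (simp_all add: linear_diff[OF linear_A])
        finally show "norm (df (A x) - df (A u)) \<le> L * (a * norm (x - u))" .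
        show "norm (A z - A u) \<le> a * norm (z - u)"
          using a(2)[of "z - u"] by (simp add: linear_diff[OF linear_A])
      qed (use L a in auto)
      finally have "perturbed 0 u - perturbed 0 z \<le> k * norm v * dist u z"
        using t by (simp add: k_def xu dist_norm norm_minus_commute[of z u] power2_eq_square algebra_simps)
      with grow[OF z(1)] have le: "\<alpha> * (dist u z)\<^sup>2 \<le> k * norm v * dist u z"
        by (simp add: z(2))
      have "dist u z \<le> k / \<alpha> * norm v"
      proof (cases "dist u z = 0")
        case True
        then show ?thesis using k \<alpha> by simp
      next
        case False
        then have "\<alpha> * dist u z \<le> k * norm v"
          using le by (simp add: power2_eq_square)
        then show ?thesis using \<alpha> by (simp add: field_simps)
      qed
      moreover have "infdist x solutions \<le> dist x u + dist u z"
        using infdist_triangle[of x solutions u] z(2) by simp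
      ultimately have "infdist x solutions \<le> t * norm v + k / \<alpha> * norm v"
        using \<open>dist x u = t * norm v\<close> by simp
      also have "\<dots> \<le> \<gamma> * norm v"
        using B by (simp add: \<gamma>_def algebra_simps)
      finally show ?thesis by (simp add: v_def)
    qed
  qed
  moreover have "\<gamma> > 0" using B t k \<alpha> by (simp add: \<gamma>_def add_pos_nonneg)
  ultimately show ?thesis by blast
qed

end

section \<open>Existence of the prox point\<close>

text \<open>The minimizer of the tilted function provides an affine minorant of \<open>G\<close>,
  which the quadratic term dominates, so lower level sets are bounded.\<close>

lemma argmin_on_prox_nonempty:
  fixes G :: "'a::euclidean_space \<Rightarrow> real"
  assumes cl: "closed (epigraph C G)" and x0: "x0 \<in> argmin_on C (tilt G v)" and t: "t > 0"
  shows "argmin_on C (\<lambda>y. 1 / (2 * t) * (norm (y - b))\<^sup>2 + G y) \<noteq> {}"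
proof (rule argmin_on_nonempty)
  let ?F = "\<lambda>y. 1 / (2 * t) * (norm (y - b))\<^sup>2 + G y"
  show "closed (epigraph C ?F)"
    by (intro closed_epigraph_add cl continuous_intros)
  show "x0 \<in> C" using x0 by (simp add: argmin_on_def)
  \<comment> \<open>Multiplying the level inequality by \<open>2 * t\<close> gives
    \<open>r\<^sup>2 \<le> K + l * r\<close>, which fails for
    \<open>r > 1 + l + \<bar>K\<bar>\<close>.\<close>
  define K where "K = 2 * t * (?F x0 - tilt G v x0 - v \<bullet> b)"
  define l where "l = 2 * t * norm v"
  have l: "l \<ge> 0" using t by (simp add: l_def)
  have "dist b y \<le> 1 + l + \<bar>K\<bar>" if y: "y \<in> C" "?F y \<le> ?F x0" for y
  proof (rule ccontr)
    define r where "r = norm (y - b)"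
    assume "\<not> dist b y \<le> 1 + l + \<bar>K\<bar>"
    then have r: "r > 1 + l + \<bar>K\<bar>" by (simp add: r_def dist_norm norm_minus_commute)
    have "tilt G v x0 \<le> tilt G v y" using x0 y by (simp add: argmin_on_def)
    moreover have "- (v \<bullet> (y - b)) \<le> norm v * r"
      using norm_cauchy_schwarz[of "- v" "y - b"] by (simp add: r_def)
    ultimately have "1 / (2 * t) * r\<^sup>2 \<le> (?F x0 - tilt G v x0 - v \<bullet> b) + norm v * r"
      using y(2) unfolding r_def[symmetric] by (simp add: inner_diff_right)
    then have "2 * t * (1 / (2 * t) * r\<^sup>2) \<le> 2 * t * ((?F x0 - tilt G v x0 - v \<bullet> b) + norm v * r)"
      using t by (intro mult_left_mono) auto
    then have "r\<^sup>2 \<le> K + l * r"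
      using t unfolding K_def l_def by (simp add: distrib_left)
    also have "\<dots> \<le> \<bar>K\<bar> * r + l * r"
    proof -
      have "\<bar>K\<bar> * 1 \<le> \<bar>K\<bar> * r" using r l by (intro mult_left_mono) auto
      then show ?thesis by simp
    qed
    also have "\<dots> = (\<bar>K\<bar> + l) * r" by (simp add: algebra_simps)
    also have "\<dots> < r * r" using r l by (intro mult_strict_right_mono) auto
    finally show False by (simp add: power2_eq_square)
  qed
  then have "{y \<in> C. ?F y \<le> ?F x0} \<subseteq> cball b (1 + l + \<bar>K\<bar>)" by auto
  then show "bounded {y \<in> C. ?F y \<le> ?F x0}" using bounded_cball bounded_subset by blast
qed

section \<open>Translation of the extended-real notions\<close>

lemma ereal_epigraph_extended: "ereal_epigraph (extended C G) = epigraph C G"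
  by (auto simp: ereal_epigraph_def epigraph_def extended_def split: if_splits)

lemma proper_closed_convex_extended:
  assumes "proper_fun g" "closed_convex_fun g"
  obtains C G where "g = extended C G" "C \<noteq> {}" "convex_on C G" "closed (epigraph C G)"
proof
  let ?C = "effective_domain g" and ?G = "\<lambda>x. real_of_ereal (g x)"
  show g: "g = extended ?C ?G"
    using assms(1)
    by (force simp: fun_eq_iff extended_def effective_domain_def proper_fun_def ereal_real)
  show "?C \<noteq> {}"
    using assms(1) by (auto simp: effective_domain_def proper_fun_def)
  show "convex_on ?C ?G" "closed (epigraph ?C ?G)"
    using assms(2) ereal_epigraph_extended[of ?C ?G]
    unfolding closed_convex_fun_def g[symmetric] by (simp_all add: convex_epigraph)
qed

text \<open>If \<open>C\<close> were empty, every point would minimize the constant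
  infinity.\<close>

lemma minimizers_extended:
  assumes "C \<noteq> {}"
  shows "minimizers (extended C F) = argmin_on C F"
proof -
  obtain c where "c \<in> C" using assms by blast
  then show ?thesis
    by (auto simp: minimizers_def is_arg_min_def argmin_on_def extended_def not_less split: if_splits)
qed

lemma INF_extended:
  assumes "z \<in> argmin_on C F"
  shows "(INF x. extended C F x) = ereal (F z)"
proof (rule antisym)
  show "(INF x. extended C F x) \<le> ereal (F z)"
    by (rule INF_lower2[of z]) (use assms in \<open>auto simp: extended_def argmin_on_def\<close>)
  show "ereal (F z) \<le> (INF x. extended C F x)"
    by (rule INF_greatest) (use assms in \<open>auto simp: extended_def argmin_on_def\<close>)
qed

lemma zero_subgradient_extended: "{z. 0 \<in> subdifferential (extended C F) z} = argmin_on C F"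
  by (auto simp: subdifferential_def extended_def argmin_on_def split: if_splits)

lemma tilted_extended: "tilted (extended C G) v = extended C (tilt G v)"
  by (auto simp: fun_eq_iff tilted_def extended_def)

text \<open>Firm convexity is applied on the compact closure of the bounded set. The real distance
  never exceeds the extended one, and the factor 1/2 is absorbed into the constant.\<close>

lemma firmly_convex_extended:
  assumes "firmly_convex (extended C G) v"
  shows "quadratic_growth C (tilt G v)"
  unfolding quadratic_growth_def
proof (intro allI impI)
  let ?M = "argmin_on C (tilt G v)"
  fix X :: "'a set" assume "bounded X"
  then obtain \<alpha> where \<alpha>: "\<alpha> > 0"
    "\<And>x. x \<in> closure X \<Longrightarrow> (INF z. extended C (tilt G v) z)
        + ereal (\<alpha> / 2) * (ereal_dist_set x ?M)\<^sup>2 \<le> extended C (tilt G v) x"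
    using assms unfolding firmly_convex_def tilted_extended zero_subgradient_extended
    by (meson compact_closure)
  have "tilt G v z + \<alpha> / 2 * (infdist x ?M)\<^sup>2 \<le> tilt G v x"
    if x: "x \<in> X" "x \<in> C" and z: "z \<in> ?M" for x z
  proof -
    have "ereal (infdist x ?M) \<le> ereal_dist_set x ?M"
      unfolding ereal_dist_set_def by (intro INF_greatest) (simp add: infdist_le)
    moreover have "0 \<le> ereal_dist_set x ?M"
      unfolding ereal_dist_set_def by (intro INF_greatest) simp
    ultimately have "(ereal (infdist x ?M))\<^sup>2 \<le> (ereal_dist_set x ?M)\<^sup>2"
      unfolding power2_eq_square by (intro ereal_mult_mono) (auto simp: infdist_nonneg)
    then have "ereal (\<alpha> / 2) * (ereal (infdist x ?M))\<^sup>2 \<le> ereal (\<alpha> / 2) * (ereal_dist_set x ?M)\<^sup>2"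
      using \<alpha>(1) by (intro ereal_mult_left_mono) auto
    then have "ereal (tilt G v z) + ereal (\<alpha> / 2) * (ereal (infdist x ?M))\<^sup>2
        \<le> extended C (tilt G v) x"
      using \<alpha>(2)[of x] x(1) closure_subset[of X] unfolding INF_extended[OF z]
      by (meson add_left_mono order_trans subsetD)
    then show ?thesis using x(2) by (simp add: extended_def)
  qed
  then show "\<exists>\<alpha>>0. \<forall>x\<in>X \<inter> C. \<forall>z\<in>?M. tilt G v z + \<alpha> * (infdist x ?M)\<^sup>2 \<le> tilt G v x"
    using \<alpha>(1) by (intro exI[of _ "\<alpha> / 2"]) auto
qed

text \<open>The choice in \<open>arg_min\<close> yields a minimizer as soon as one exists; the error
  bound is stated for every minimizer of the prox problem.\<close>

lemma prox_extended:
  assumes "C \<noteq> {}" "argmin_on C (\<lambda>y. 1 / (2 * t) * (norm (y - b))\<^sup>2 + G y) \<noteq> {}"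
  shows "prox t (extended C G) b \<in> argmin_on C (\<lambda>y. 1 / (2 * t) * (norm (y - b))\<^sup>2 + G y)"
proof -
  let ?F = "\<lambda>y. 1 / (2 * t) * (norm (y - b))\<^sup>2 + G y"
  have "(\<lambda>y. extended C G y + ereal (1 / (2 * t) * (norm (y - b))\<^sup>2)) = extended C ?F"
    by (auto simp: fun_eq_iff extended_def)
  then have eq: "prox t (extended C G) b = (SOME x. x \<in> minimizers (extended C ?F))"
    by (simp add: prox_def arg_min_def minimizers_def)
  show ?thesis
    unfolding eq minimizers_extended[OF assms(1)] using assms(2) by (simp add: some_in_eq)
qed

theorem theorem4p2:
  fixes f :: "real ^ 'm \<Rightarrow> real" and df :: "real ^ 'm \<Rightarrow> real ^ 'm"
    and g :: "real ^ 'n \<Rightarrow> ereal"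
    and A :: "real ^ 'n \<Rightarrow> real ^ 'm"
    and ybar :: "real ^ 'm"
  assumes "proper_fun g" and "closed_convex_fun g"
    and "convex_on UNIV f"
    and "\<forall>y. GDERIV f y :> df y" and "continuous_on UNIV df"
    and "\<exists>L. L-lipschitz_on UNIV df"
    and "linear A"
    and "minimizers (primal_obj f g A) \<noteq> {}"
    and "is_arg_max (\<lambda>y. - dual_obj f g A y) (\<lambda>_. True) ybar"
    and compactness: "bounded (minimizers (primal_obj f g A))"
    and nondegeneracy:
      "0 \<in> adjoint A ` rel_interior (effective_domain (fenchel_conjugate (\<lambda>y. ereal (f y))))
         + rel_interior (effective_domain (fenchel_conjugate g))"
    and strict_complementarity:
      "0 \<in> rel_interior (subdifferential (dual_obj f g A) ybar)"
    and growth_f: "firmly_convex (\<lambda>y. ereal (f y)) ybar"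
    and growth_g: "firmly_convex g (- adjoint A ybar)"
  shows "\<forall>t>0. \<exists>\<gamma>>0. \<exists>\<nu>>0. \<forall>x.
           primal_obj f g A x \<le> (INF z. primal_obj f g A z) + ereal \<nu> \<longrightarrow>
           infdist x (minimizers (primal_obj f g A)) \<le> \<gamma> * norm (prox_gradient_map df g A t x)"
proof (intro allI impI)
  fix t :: real assume t: "t > 0"
  obtain C G where g: "g = extended C G" and C: "C \<noteq> {}"
    and G: "convex_on C G" "closed (epigraph C G)"
    using proper_closed_convex_extended[OF assms(1,2)] by blast
  obtain L where L: "L-lipschitz_on UNIV df" using assms(6) by blast
  interpret composite_problem f df G C A
    using assms(3,4,7) G by (intro composite_problem.intro) auto
  have primal: "primal_obj f g A = extended C (perturbed 0)"
    by (auto simp: g fun_eq_iff primal_obj_def extended_def perturbed_def)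
  note sol = minimizers_extended[OF C, of "perturbed 0", folded primal]
  interpret bounded_composite_problem f df G C A
    using assms(8) compactness unfolding sol
    by (intro bounded_composite_problem.intro bounded_composite_problem_axioms.intro
        composite_problem_axioms)
  obtain x0 where x0: "x0 \<in> solutions" using solutions_nonempty by blast
  have f: "(\<lambda>y. ereal (f y)) = extended UNIV f" by (simp add: extended_def fun_eq_iff)
  have "quadratic_growth C (perturbed 0)"
    using quadratic_growth_solutions[OF strict_complementarity[unfolded g]
        firmly_convex_extended[OF growth_f[unfolded f]] firmly_convex_extended[OF growth_g[unfolded g]]] .
  \<comment> \<open>The margin 1 becomes \<open>\<nu>\<close>. The bound holds below every level,
    with \<open>\<gamma>\<close> depending on the level.\<close>
  from error_bound_of_quadratic_growth[OF L this t, of "perturbed 0 x0 + 1"]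
  obtain \<gamma> where \<gamma>: "\<gamma> > 0"
    "\<forall>x\<in>C. perturbed 0 x \<le> perturbed 0 x0 + 1 \<longrightarrow>
      (\<forall>u\<in>argmin_on C (\<lambda>y. 1 / (2 * t) * (norm (y - (x - t *\<^sub>R adjoint A (df (A x)))))\<^sup>2 + G y).
        infdist x solutions \<le> \<gamma> * norm ((1 / t) *\<^sub>R (x - u)))"
    by blast
  have "infdist x solutions \<le> \<gamma> * norm (prox_gradient_map df g A t x)"
    if x: "primal_obj f g A x \<le> (INF z. primal_obj f g A z) + ereal 1" for x
  proof -
    have "x \<in> C" "perturbed 0 x \<le> perturbed 0 x0 + 1"
      using x unfolding primal INF_extended[OF x0]
      by (auto simp: extended_def split: if_splits)
    \<comment> \<open>The dual multiplier at the solution \<open>x0\<close> supplies the tilt that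
      makes every prox problem solvable.\<close>
    moreover note prox_extended[OF C argmin_on_prox_nonempty[OF G(2) perturbed_argmin_dual(2)[OF x0] t]]
    ultimately show ?thesis
      unfolding prox_gradient_map_def g by (rule \<gamma>(2)[rule_format])
  qed
  then show "\<exists>\<gamma>>0. \<exists>\<nu>>0. \<forall>x. primal_obj f g A x \<le> (INF z. primal_obj f g A z) + ereal \<nu> \<longrightarrow>
      infdist x (minimizers (primal_obj f g A)) \<le> \<gamma> * norm (prox_gradient_map df g A t x)"
    using \<gamma>(1) unfolding sol by (intro exI[of _ \<gamma>] conjI exI[of _ "1::real"]) auto
qed

end
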